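(* Let $f_{\theta_n}(\cdot)=f(\cdot;\theta_n)$ be an empirical risk minimizer over a class of feedforward neural networks with $L$ hidden layers, whose parameter $\theta_n$ has $(d_1^*,\ldots,d_L^* )$ distinct permutations in its hidden layers and satisfies $\Delta_{\min}(\theta_n)=\delta$. Let $\mathcal{A}$ be any optimization algorithm which is guaranteed to produce a convergent solution of $\theta_n$ (i.e. to converge to $\theta_n$) whenever its initialization $\theta_n^{(0)}$ satisfies $\Delta_{\max}(\theta_n^{(0)}-\theta_n)\le\delta/2$. Then, for any initialization scheme that uses identical random distributions for the entries of weights and biases within a layer, with random initialization denoted $\theta^{(0)}$, the algorithm $\mathcal{A}$ started at $\theta^{(0)}$ produces a convergent solution (i.e. converges to a parameter whose network is an empirical risk minimizer) with probability at least $$d_1^*\times\cdots\times d_L^*\times\mathbb{P}\big(\Delta_{\max}(\theta^{(0)}-\theta_n)\le\delta/2\big),$$ where $\mathbb{P}$ is with respect to the randomness of the initialization.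
   Context: Networks: $f(x;\theta)=\mathcal{A}_{L+1}\circ\sigma_L\circ\mathcal{A}_L\circ\cdots\circ\sigma_1\circ\mathcal{A}_1(x)$ with $\mathcal{A}_l(y)=W^{(l)}y+b^{(l)}$, $W^{(l)}\in\mathbb{R}^{d_l\times d_{l-1}}$, $b^{(l)}\in\mathbb{R}^{d_l}$, $d_{L+1}=1$, activations $\sigma_l:\mathbb{R}\to\mathbb{R}$ applied element-wise, and $\theta=(W^{(1)},b^{(1)},\ldots,W^{(L+1)},b^{(L+1)})$ ranging over $\Theta=[-B,B]^{\mathcal{S}}$ (all entries bounded by $B\ge1$ in absolute value), $\mathcal{S}$ being the total number of parameters. Empirical risk minimizer: given an empirical risk $\mathcal{R}_n$ (a real-valued functional of the function $f$, computed from a sample of size $n$), an empirical risk minimizer is a network $f_{\theta_n}\in\arg\min_{f\in\{f(\cdot;\theta):\theta\in\Theta\}}\mathcal{R}_n(f)$. Rows: for $l=1,\ldots,L$ let $\theta^{(l)}=(W^{(l)};b^{(l)})$ be the $d_l\times(d_{l-1}+1)$ matrix obtained by concatenating $W^{(l)}$ and $b^{(l)}$, and let $\theta^{(l)}_i$ be its $i$-th row. Let $d_l^*$ be the number of distinct permutations of the rows of $\theta_n^{(l)}$, i.e. the number of distinct matrices obtained from $\theta_n^{(l)}$ by permuting its rows (so $1\le d_l^*\le d_l!$). Definitions of $\Delta_{\min},\Delta_{\max}$: $$\Delta_{\min}(\theta)=\min_{l\in\{1,\ldots,L\}}\ \min_{i,j\in\{1,\ldots,d_l\},\ \theta^{(l)}_i\ne\theta^{(l)}_j}\|\theta^{(l)}_i-\theta^{(l)}_j\|_\infty,\qquad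 \Delta_{\max}(\theta)=\max_{l\in\{1,\ldots,L\}}\ \max_{i,j\in\{1,\ldots,d_l\}}\|\theta^{(l)}_i-\theta^{(l)}_j\|_\infty,$$ where $\|\cdot\|_\infty$ is the maximum absolute entry. Initialization scheme using identical random distributions within a layer: the random $\theta^{(0)}=(W^{(1)}_{(0)},b^{(1)}_{(0)},\ldots,W^{(L+1)}_{(0)},b^{(L+1)}_{(0)})$ is such that, for each $l$, the entries of $W^{(l)}_{(0)}$ are independent and identically distributed and the entries of $b^{(l)}_{(0)}$ are independent and identically distributed.
   Formalization: The convergence guarantee is assumed near every renumbering of the hidden units of θ_n (limit up to renumbering), not only near θ_n, and all initial entries are assumed mutually independent across weights, biases and layers; without these the claim fails. *)

theory Defs
  imports "HOL-Probability.Probability" "Jordan_Normal_Form.Matrix"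
begin

unbundle no vec_syntax

(* Layers are numbered 1..L+1 and layer l maps R^(d (l - 1)) to R^(d l); units within a layer are
   numbered from 0. The entry (i, j) of W^(l) is addressed by Weight l i j and the entry i of b^(l)
   by Bias l i. A parameter is a real function on these addresses, of which only the values on
   param_index d L matter. *)
datatype pidx = Weight nat nat nat | Bias nat nat

type_synonym param = "pidx \<Rightarrow> real"

definition param_index :: "(nat \<Rightarrow> nat) \<Rightarrow> nat \<Rightarrow> pidx set" where
  "param_index d L =
     {Weight l i j | l i j. l \<in> {1..L + 1} \<and> i < d l \<and> j < d (l - 1)}
     \<union> {Bias l i | l i. l \<in> {1..L + 1} \<and> i < d l}"

definition param_space :: "(nat \<Rightarrow> nat) \<Rightarrow> nat \<Rightarrow> real \<Rightarrow> param set" where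
  "param_space d L B = {\<theta>. \<forall>p \<in> param_index d L. \<bar>\<theta> p\<bar> \<le> B}"

definition weight_mat :: "(nat \<Rightarrow> nat) \<Rightarrow> param \<Rightarrow> nat \<Rightarrow> real mat" where
  "weight_mat d \<theta> l = mat (d l) (d (l - 1)) (\<lambda>(i, j). \<theta> (Weight l i j))"

definition bias_vec :: "(nat \<Rightarrow> nat) \<Rightarrow> param \<Rightarrow> nat \<Rightarrow> real Matrix.vec" where
  "bias_vec d \<theta> l = Matrix.vec (d l) (\<lambda>i. \<theta> (Bias l i))"

definition affine :: "(nat \<Rightarrow> nat) \<Rightarrow> param \<Rightarrow> nat \<Rightarrow> real Matrix.vec \<Rightarrow> real Matrix.vec" where
  "affine d \<theta> l y = weight_mat d \<theta> l *\<^sub>v y + bias_vec d \<theta> l"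

primrec hidden :: "(nat \<Rightarrow> nat) \<Rightarrow> (nat \<Rightarrow> real \<Rightarrow> real) \<Rightarrow> param \<Rightarrow> real Matrix.vec \<Rightarrow> nat \<Rightarrow> real Matrix.vec"
  where
    "hidden d \<sigma> \<theta> x 0 = x"
  | "hidden d \<sigma> \<theta> x (Suc l) = map_vec (\<sigma> (Suc l)) (affine d \<theta> (Suc l) (hidden d \<sigma> \<theta> x l))"

(* Restricting to inputs of dimension d 0 makes equality of networks, and hence the value of a
   functional of the network, depend on their values on R^(d 0) only. *)
definition network ::
  "(nat \<Rightarrow> nat) \<Rightarrow> nat \<Rightarrow> (nat \<Rightarrow> real \<Rightarrow> real) \<Rightarrow> param \<Rightarrow> real Matrix.vec \<Rightarrow> real" where
  "network d L \<sigma> \<theta> = (\<lambda>x \<in> carrier_vec (d 0). affine d \<theta> (L + 1) (hidden d \<sigma> \<theta> x L) $ 0)"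

definition is_erm ::
  "(nat \<Rightarrow> nat) \<Rightarrow> nat \<Rightarrow> (nat \<Rightarrow> real \<Rightarrow> real) \<Rightarrow> real \<Rightarrow>
   ((real Matrix.vec \<Rightarrow> real) \<Rightarrow> real) \<Rightarrow> param \<Rightarrow> bool" where
  "is_erm d L \<sigma> B R \<theta> \<longleftrightarrow>
     \<theta> \<in> param_space d L B \<and> is_arg_min R (\<lambda>f. f \<in> network d L \<sigma> ` param_space d L B) (network d L \<sigma> \<theta>)"

definition layer_mat :: "(nat \<Rightarrow> nat) \<Rightarrow> param \<Rightarrow> nat \<Rightarrow> real mat" where
  "layer_mat d \<theta> l = mat (d l) (d (l - 1) + 1)
     (\<lambda>(i, j). if j < d (l - 1) then weight_mat d \<theta> l $$ (i, j) else bias_vec d \<theta> l $ i)"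

definition distinct_row_perms :: "(nat \<Rightarrow> nat) \<Rightarrow> param \<Rightarrow> nat \<Rightarrow> nat" where
  "distinct_row_perms d \<theta> l =
     card {mat (d l) (d (l - 1) + 1) (\<lambda>(i, j). layer_mat d \<theta> l $$ (\<pi> i, j)) | \<pi>. \<pi> permutes {..<d l}}"

definition linf_norm :: "real Matrix.vec \<Rightarrow> real" where
  "linf_norm v = Max {\<bar>v $ j\<bar> | j. j < dim_vec v}"

(* Extended-real valued: the infimum is over an empty set, hence infinite, when within each hidden
   layer all rows coincide. *)
definition Delta_min :: "(nat \<Rightarrow> nat) \<Rightarrow> nat \<Rightarrow> param \<Rightarrow> ereal" where
  "Delta_min d L \<theta> =
     Inf {ereal (linf_norm (row (layer_mat d \<theta> l) i - row (layer_mat d \<theta> l) j)) | l i j.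
            l \<in> {1..L} \<and> i < d l \<and> j < d l \<and> row (layer_mat d \<theta> l) i \<noteq> row (layer_mat d \<theta> l) j}"

definition Delta_max :: "(nat \<Rightarrow> nat) \<Rightarrow> nat \<Rightarrow> param \<Rightarrow> real" where
  "Delta_max d L \<theta> =
     Max {linf_norm (row (layer_mat d \<theta> l) i - row (layer_mat d \<theta> l) j) | l i j.
            l \<in> {1..L} \<and> i < d l \<and> j < d l}"

definition hidden_perms :: "(nat \<Rightarrow> nat) \<Rightarrow> nat \<Rightarrow> (nat \<Rightarrow> nat \<Rightarrow> nat) set" where
  "hidden_perms d L =
     {\<pi>. (\<forall>l \<in> {1..L}. \<pi> l permutes {..<d l}) \<and> (\<forall>l. l \<notin> {1..L} \<longrightarrow> \<pi> l = id)}"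

(* Renumbering the units of hidden layer l by \<pi> l permutes the rows of (W^(l); b^(l)) and, with
   them, the columns of W^(l+1). *)
fun relabel :: "(nat \<Rightarrow> nat \<Rightarrow> nat) \<Rightarrow> param \<Rightarrow> param" where
  "relabel \<pi> \<theta> (Weight l i j) = \<theta> (Weight l (\<pi> l i) (\<pi> (l - 1) j))"
| "relabel \<pi> \<theta> (Bias l i) = \<theta> (Bias l (\<pi> l i))"

definition converges_to :: "(nat \<Rightarrow> nat) \<Rightarrow> nat \<Rightarrow> (nat \<Rightarrow> param) \<Rightarrow> param \<Rightarrow> bool" where
  "converges_to d L s \<theta> \<longleftrightarrow> (\<forall>p \<in> param_index d L. (\<lambda>k. s k p) \<longlonglongrightarrow> \<theta> p)"

(* An algorithm maps an initialization to its sequence of iterates. Since a parameter is determined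
   only up to the numbering of its hidden units, the guarantee concerns every numbering \<theta>' of \<theta>,
   and the limit is asked to be \<theta> up to numbering. A guarantee near one numbering alone would say
   nothing about initializations near the others. Asking for the limit \<theta>' itself would be
   contradictory when two hidden units share the same row but have different outgoing weights:
   two numberings can then have the same neighbourhood. *)
definition guaranteed_near ::
  "(nat \<Rightarrow> nat) \<Rightarrow> nat \<Rightarrow> (param \<Rightarrow> nat \<Rightarrow> param) \<Rightarrow> ereal \<Rightarrow> param \<Rightarrow> bool" where
  "guaranteed_near d L \<A> r \<theta> \<longleftrightarrow>
     (\<forall>\<pi> \<in> hidden_perms d L. \<forall>\<theta>\<^sub>0. ereal (Delta_max d L (\<theta>\<^sub>0 - relabel \<pi> \<theta>)) \<le> r \<longrightarrow>
        (\<exists>\<rho> \<in> hidden_perms d L. converges_to d L (\<A> \<theta>\<^sub>0) (relabel \<rho> \<theta>)))"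

(* All entries are mutually independent; the common distribution may differ from layer to layer and
   between the weights and the biases of a layer. *)
definition layerwise_iid :: "(nat \<Rightarrow> nat) \<Rightarrow> nat \<Rightarrow> 'w measure \<Rightarrow> ('w \<Rightarrow> param) \<Rightarrow> bool" where
  "layerwise_iid d L M X \<longleftrightarrow>
     prob_space.indep_vars M (\<lambda>_. borel) (\<lambda>p \<omega>. X \<omega> p) (param_index d L) \<and>
     (\<forall>l \<in> {1..L + 1}. \<forall>i < d l. \<forall>i' < d l.
        (\<forall>j < d (l - 1). \<forall>j' < d (l - 1).
           distr M borel (\<lambda>\<omega>. X \<omega> (Weight l i j)) = distr M borel (\<lambda>\<omega>. X \<omega> (Weight l i' j'))) \<and>
        distr M borel (\<lambda>\<omega>. X \<omega> (Bias l i)) = distr M borel (\<lambda>\<omega>. X \<omega> (Bias l i')))"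

end

theory Submission
  imports Defs
begin

text \<open>
  Renumbering the hidden units by \<open>\<pi>\<close> changes neither the network nor, for a layerwise i.i.d.
  initialization, the law of the parameter; as \<open>Delta_max\<close> is invariant as well, all events
  \<open>Delta_max (\<theta>\<^sub>0 - relabel \<pi> \<theta>\<^sub>n) \<le> \<delta> / 2\<close> have the same probability, and on each of them the
  algorithm reaches a renumbering of \<open>\<theta>\<^sub>n\<close>. Choosing one permutation per distinct row arrangement
  in every hidden layer gives \<open>d\<^sub>1\<^sup>* \<cdots> d\<^sub>L\<^sup>*\<close> events, and these are disjoint: in the first layer where
  \<open>\<pi>\<close> and \<open>\<rho>\<close> differ, their columns are numbered alike, so the two arrangements have rows whose
  differences \<open>u\<^sub>i\<close> sum to zero. Some \<open>u\<^sub>i\<close> has an entry of size at least \<open>\<delta>\<close>, and some \<open>u\<^sub>j\<close> has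
  an entry of opposite sign in that column, so that \<open>u\<^sub>i - u\<^sub>j\<close> exceeds \<open>\<delta>\<close>, whereas a common point of
  both events would bound it by \<open>\<delta> / 2 + \<delta> / 2\<close>.
\<close>

section \<open>Auxiliary facts on permutations, maxima and zero sums\<close>

lemma permutes_ball3_iff:
  assumes "\<pi> permutes A" "\<rho> permutes C"
  shows "(\<forall>i\<in>A. \<forall>j\<in>A. \<forall>c\<in>C. Q (\<pi> i) (\<pi> j) (\<rho> c)) \<longleftrightarrow> (\<forall>i\<in>A. \<forall>j\<in>A. \<forall>c\<in>C. Q i j c)"
proof -
  have "(\<forall>i\<in>\<pi> ` A. \<forall>j\<in>\<pi> ` A. \<forall>c\<in>\<rho> ` C. Q i j c) \<longleftrightarrow>
      (\<forall>i\<in>A. \<forall>j\<in>A. \<forall>c\<in>C. Q (\<pi> i) (\<pi> j) (\<rho> c))"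
    by simp
  then show ?thesis
    by (simp only: permutes_image[OF assms(1)] permutes_image[OF assms(2)])
qed

text \<open>The radius is half of \<open>Delta_min\<close>, which may be infinite, so real maxima
  are compared with it in \<open>ereal\<close>.\<close>

lemma ereal_Max_le_iff:
  assumes "finite S" "S \<noteq> {}"
  shows "ereal (Max S) \<le> r \<longleftrightarrow> (\<forall>x\<in>S. ereal x \<le> r)"
  using assms by (cases r) auto

text \<open>If no \<open>u j\<close> had the sign opposite to \<open>u i\<close>, the products
  \<open>u i * u j\<close> would be nonnegative with sum zero, hence all zero, including the square
  of \<open>u i\<close>. Subtracting a number of opposite sign increases the absolute value.\<close>

lemma sum_zero_gap:
  fixes u :: "'a \<Rightarrow> real"
  assumes "finite S" "sum u S = 0" "i \<in> S" "u i \<noteq> 0"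
  obtains j where "j \<in> S" "\<bar>u i\<bar> < \<bar>u i - u j\<bar>"
proof -
  have "\<exists>j\<in>S. u i * u j < 0"
  proof (rule ccontr)
    assume "\<not> ?thesis"
    then have "\<forall>j\<in>S. 0 \<le> u i * u j" by (simp add: not_less)
    moreover have "(\<Sum>j\<in>S. u i * u j) = 0"
      using assms(2) by (simp flip: sum_distrib_left)
    ultimately have "u i * u i = 0"
      using assms(1,3) by (subst (asm) sum_nonneg_eq_0_iff) auto
    then show False using assms(4) by simp
  qed
  then obtain j where "j \<in> S" "u i * u j < 0" by blast
  then show thesis
    using that[of j] by (auto simp: mult_less_0_iff)
qed

section \<open>Entrywise forms of \<open>Delta_max\<close> and \<open>Delta_min\<close>\<close>

text \<open>Column \<open>d (l - 1)\<close> of the layer matrix holds the biases.\<close>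

definition addr :: "(nat \<Rightarrow> nat) \<Rightarrow> nat \<Rightarrow> nat \<Rightarrow> nat \<Rightarrow> pidx" where
  "addr d l i c = (if c < d (l - 1) then Weight l i c else Bias l i)"

lemma layer_mat_addr:
  assumes "i < d l" "c \<le> d (l - 1)"
  shows "layer_mat d \<theta> l $$ (i, c) = \<theta> (addr d l i c)"
  using assms by (simp add: layer_mat_def weight_mat_def bias_vec_def addr_def)

lemma dim_layer_mat [simp]:
  "dim_row (layer_mat d \<theta> l) = d l" "dim_col (layer_mat d \<theta> l) = d (l - 1) + 1"
  by (simp_all add: layer_mat_def)

lemma row_diff_addr:
  assumes "i < d l" "j < d l" "c \<le> d (l - 1)"
  shows "(row (layer_mat d \<theta> l) i - row (layer_mat d \<theta> l) j) $ c = \<theta> (addr d l i c) - \<theta> (addr d l j c)"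
  using assms by (simp add: layer_mat_addr)

lemma addr_in_param_index:
  assumes "l \<in> {1..L + 1}" "i < d l"
  shows "addr d l i c \<in> param_index d L"
  using assms by (auto simp: addr_def param_index_def)

lemma linf_norm_le_iff:
  assumes "0 < dim_vec v"
  shows "ereal (linf_norm v) \<le> r \<longleftrightarrow> (\<forall>j<dim_vec v. ereal \<bar>v $ j\<bar> \<le> r)"
proof -
  have "{\<bar>v $ j\<bar> | j. j < dim_vec v} = (\<lambda>j. \<bar>v $ j\<bar>) ` {..<dim_vec v}" by auto
  moreover have "(\<lambda>j. \<bar>v $ j\<bar>) ` {..<dim_vec v} \<noteq> {}" using assms by auto
  ultimately show ?thesis
    unfolding linf_norm_def by (subst ereal_Max_le_iff) auto
qed

lemma linf_norm_attained:
  assumes "0 < dim_vec v"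
  obtains j where "j < dim_vec v" "linf_norm v = \<bar>v $ j\<bar>"
proof -
  let ?S = "(\<lambda>j. \<bar>v $ j\<bar>) ` {..<dim_vec v}"
  have "{\<bar>v $ j\<bar> | j. j < dim_vec v} = ?S" by auto
  then have "linf_norm v = Max ?S" by (simp only: linf_norm_def)
  moreover have "Max ?S \<in> ?S" using assms by (intro Max_in) auto
  ultimately show thesis using that by (metis imageE lessThan_iff)
qed

text \<open>As bounded quantifiers over addresses, the condition can be reindexed by permutations
  and shown measurable entry by entry.\<close>

lemma Delta_max_le_iff:
  assumes "L \<ge> 1" "\<forall>l\<le>L. d l \<ge> 1"
  shows "ereal (Delta_max d L \<theta>) \<le> r \<longleftrightarrow>
    (\<forall>l\<in>{1..L}. \<forall>i\<in>{..<d l}. \<forall>j\<in>{..<d l}. \<forall>c\<in>{..d (l - 1)}.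
       ereal \<bar>\<theta> (addr d l i c) - \<theta> (addr d l j c)\<bar> \<le> r)"
proof -
  define g where "g l i j = linf_norm (row (layer_mat d \<theta> l) i - row (layer_mat d \<theta> l) j)" for l i j
  let ?f = "\<lambda>(l, i, j). g l i j"
  let ?T = "SIGMA l:{1..L}. {..<d l} \<times> {..<d l}"
  have img: "{g l i j | l i j. l \<in> {1..L} \<and> i < d l \<and> j < d l} = ?f ` ?T"
    by force
  \<comment> \<open>Layer 1 exists and has a unit 0, so the maximum is over a nonempty set.\<close>
  have "(1, 0, 0) \<in> ?T" using assms by (auto simp: Suc_le_eq)
  then have "?f ` ?T \<noteq> {}" by blast
  then have "ereal (Delta_max d L \<theta>) \<le> r \<longleftrightarrow> (\<forall>x\<in>?f ` ?T. ereal x \<le> r)"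
    unfolding Delta_max_def g_def[symmetric] img by (intro ereal_Max_le_iff) auto
  also have "\<dots> \<longleftrightarrow> (\<forall>l\<in>{1..L}. \<forall>i\<in>{..<d l}. \<forall>j\<in>{..<d l}. ereal (g l i j) \<le> r)"
    by (simp only: Set.ball_simps split_paired_Ball_Sigma prod.case)
  also have "\<dots> \<longleftrightarrow> (\<forall>l\<in>{1..L}. \<forall>i\<in>{..<d l}. \<forall>j\<in>{..<d l}. \<forall>c\<in>{..d (l - 1)}.
       ereal \<bar>\<theta> (addr d l i c) - \<theta> (addr d l j c)\<bar> \<le> r)"
    unfolding g_def by (intro ball_cong refl, subst linf_norm_le_iff)
       (auto simp del: index_minus_vec(1) simp: row_diff_addr less_Suc_eq_le)
  finally show ?thesis .
qed

text \<open>The column is one where the maximum norm of the row difference is attained. That the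
  entries differ there is recorded as well, which avoids a separate proof that
  \<open>Delta_min\<close> is positive.\<close>

lemma Delta_min_le:
  assumes "l \<in> {1..L}" "i < d l" "j < d l" "row (layer_mat d \<theta> l) i \<noteq> row (layer_mat d \<theta> l) j"
  obtains c where "c \<le> d (l - 1)"
    "Delta_min d L \<theta> \<le> ereal \<bar>\<theta> (addr d l i c) - \<theta> (addr d l j c)\<bar>"
    "\<theta> (addr d l i c) \<noteq> \<theta> (addr d l j c)"
proof -
  let ?v = "row (layer_mat d \<theta> l) i - row (layer_mat d \<theta> l) j"
  obtain c where c: "c \<le> d (l - 1)" "linf_norm ?v = \<bar>?v $ c\<bar>"
    using linf_norm_attained[of ?v] by (auto simp: less_Suc_eq_le)
  have eq: "?v $ b = \<theta> (addr d l i b) - \<theta> (addr d l j b)" if "b \<le> d (l - 1)" for b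
    using that assms by (intro row_diff_addr)
  have "Delta_min d L \<theta> \<le> ereal (linf_norm ?v)"
    unfolding Delta_min_def using assms by (intro Inf_lower) blast
  moreover have "?v $ c \<noteq> 0"
  proof
    assume "?v $ c = 0"
    then have "ereal (linf_norm ?v) \<le> 0" using c by simp
    then have "\<forall>b\<le>d (l - 1). ?v $ b = 0"
      by (subst (asm) linf_norm_le_iff) (auto simp del: index_minus_vec(1) simp: less_Suc_eq_le)
    then have "\<forall>b\<le>d (l - 1). layer_mat d \<theta> l $$ (i, b) = layer_mat d \<theta> l $$ (j, b)"
      using assms by (auto simp: eq layer_mat_addr simp del: index_minus_vec(1))
    then have "row (layer_mat d \<theta> l) i = row (layer_mat d \<theta> l) j"
      using assms by (intro eq_vecI) (auto simp: less_Suc_eq_le)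
    then show False using assms by simp
  qed
  ultimately show thesis using c eq[OF c(1)] that[of c] by simp
qed

section \<open>The action of hidden unit permutations on addresses\<close>

fun renumber :: "(nat \<Rightarrow> nat \<Rightarrow> nat) \<Rightarrow> pidx \<Rightarrow> pidx" where
  "renumber \<pi> (Weight l i j) = Weight l (\<pi> l i) (\<pi> (l - 1) j)"
| "renumber \<pi> (Bias l i) = Bias l (\<pi> l i)"

text \<open>Moves the action from parameters to addresses, where it can reindex both the entries of
  a fixed parameter and the coordinates of a random one.\<close>

lemma relabel_eq: "relabel \<pi> \<theta> p = \<theta> (renumber \<pi> p)"
  by (cases p) auto

lemma hidden_perms_permutes:
  assumes "\<pi> \<in> hidden_perms d L"
  shows "\<pi> l permutes {..<d l}"
  using assms by (cases "l \<in> {1..L}") (auto simp: hidden_perms_def permutes_id)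

text \<open>The bias column needs no special case: \<open>\<pi> (l - 1)\<close> permutes the indices
  below \<open>d (l - 1)\<close> and fixes the index \<open>d (l - 1)\<close> itself.\<close>

lemma renumber_addr:
  assumes "\<pi> \<in> hidden_perms d L"
  shows "renumber \<pi> (addr d l i c) = addr d l (\<pi> l i) (\<pi> (l - 1) c)"
proof -
  have "\<pi> (l - 1) permutes {..<d (l - 1)}" using assms by (rule hidden_perms_permutes)
  from permutes_in_image[OF this, of c] show ?thesis by (auto simp: addr_def)
qed

lemma finite_param_index: "finite (param_index d L)"
proof -
  have "param_index d L \<subseteq>
      (\<lambda>(l, i, j). Weight l i j) ` (SIGMA l:{1..L + 1}. {..<d l} \<times> {..<d (l - 1)})
      \<union> (\<lambda>(l, i). Bias l i) ` (SIGMA l:{1..L + 1}. {..<d l})"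
    by (force simp: param_index_def image_def)
  then show ?thesis by (rule finite_subset) auto
qed

text \<open>An injective map of a finite set into itself is onto.\<close>

lemma bij_betw_renumber:
  assumes "\<pi> \<in> hidden_perms d L"
  shows "bij_betw (renumber \<pi>) (param_index d L) (param_index d L)"
proof -
  have perm: "\<pi> l permutes {..<d l}" for l using assms by (rule hidden_perms_permutes)
  have lt: "\<pi> l i < d l \<longleftrightarrow> i < d l" for l i
    using permutes_in_image[OF perm[of l], of i] by simp
  have eq: "\<pi> l i = \<pi> l j \<longleftrightarrow> i = j" for l i j
    using permutes_inj[OF perm[of l]] by (simp add: inj_eq)
  have "renumber \<pi> ` param_index d L \<subseteq> param_index d L"
    by (auto simp: param_index_def lt)
  moreover have "inj_on (renumber \<pi>) (param_index d L)"
  proof (rule inj_onI)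
    fix p q assume "renumber \<pi> p = renumber \<pi> q"
    then show "p = q" by (cases p; cases q) (auto simp: eq)
  qed
  ultimately show ?thesis
    using endo_inj_surj[OF finite_param_index] by (auto simp: bij_betw_def)
qed

lemma Delta_max_relabel_le_iff:
  assumes "L \<ge> 1" "\<forall>l\<le>L. d l \<ge> 1" "\<pi> \<in> hidden_perms d L"
  shows "ereal (Delta_max d L (relabel \<pi> \<theta>)) \<le> r \<longleftrightarrow> ereal (Delta_max d L \<theta>) \<le> r"
proof -
  have perm: "\<pi> l permutes {..<d l}" for l using assms(3) by (rule hidden_perms_permutes)
  \<comment> \<open>One index more than there are units: it stands for the bias column of the next
    layer.\<close>
  have perm': "\<pi> l permutes {..d l}" for l
    using perm[of l] by (rule permutes_subset) auto
  show ?thesis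
    unfolding Delta_max_le_iff[OF assms(1,2)] relabel_eq renumber_addr[OF assms(3)]
    by (rule ball_cong[OF refl]) (rule permutes_ball3_iff[OF perm perm'])
qed

lemma Delta_max_cong:
  assumes "L \<ge> 1" "\<forall>l\<le>L. d l \<ge> 1" "\<And>p. p \<in> param_index d L \<Longrightarrow> \<theta> p = \<eta> p"
  shows "ereal (Delta_max d L \<theta>) \<le> r \<longleftrightarrow> ereal (Delta_max d L \<eta>) \<le> r"
  unfolding Delta_max_le_iff[OF assms(1,2)]
  by (intro ball_cong refl) (simp add: assms(3) addr_in_param_index)

subsection \<open>Networks with renumbered hidden units\<close>

text \<open>Permuting the columns of the weights together with the entries of \<open>y\<close> only
  reorders the sum over \<open>j\<close>; permuting the rows permutes the output.\<close>

lemma affine_relabel: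
  assumes "\<pi> \<in> hidden_perms d L" "y \<in> carrier_vec (d l)"
  shows "affine d (relabel \<pi> \<theta>) (Suc l) (Matrix.vec (d l) (\<lambda>i. y $ \<pi> l i)) =
    Matrix.vec (d (Suc l)) (\<lambda>i. affine d \<theta> (Suc l) y $ \<pi> (Suc l) i)"
proof (rule eq_vecI)
  have perm: "\<pi> k permutes {..<d k}" for k using assms(1) by (rule hidden_perms_permutes)
  fix i assume "i < dim_vec (Matrix.vec (d (Suc l)) (\<lambda>i. affine d \<theta> (Suc l) y $ \<pi> (Suc l) i))"
  then have i: "i < d (Suc l)" by simp
  then have i': "\<pi> (Suc l) i < d (Suc l)"
    using permutes_in_image[OF perm, of "Suc l" i] by simp
  have "(\<Sum>j<d l. \<theta> (Weight (Suc l) (\<pi> (Suc l) i) (\<pi> l j)) * y $ \<pi> l j) =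
        (\<Sum>j<d l. \<theta> (Weight (Suc l) (\<pi> (Suc l) i) j) * y $ j)"
    using sum.permute[OF perm[of l], of "\<lambda>j. \<theta> (Weight (Suc l) (\<pi> (Suc l) i) j) * y $ j"]
    by (simp add: o_def)
  then show "affine d (relabel \<pi> \<theta>) (Suc l) (Matrix.vec (d l) (\<lambda>i. y $ \<pi> l i)) $ i =
      Matrix.vec (d (Suc l)) (\<lambda>i. affine d \<theta> (Suc l) y $ \<pi> (Suc l) i) $ i"
    using i i' assms(2)
    by (simp add: affine_def weight_mat_def bias_vec_def scalar_prod_def atLeast0LessThan)
qed (simp add: affine_def bias_vec_def)

lemma dim_affine [simp]: "dim_vec (affine d \<theta> l y) = d l"
  by (simp add: affine_def bias_vec_def)

lemma hidden_carrier:
  assumes "x \<in> carrier_vec (d 0)"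
  shows "hidden d \<sigma> \<theta> x l \<in> carrier_vec (d l)"
  using assms by (cases l) (auto intro: carrier_vecI)

text \<open>All units of a layer share one activation, so applying it commutes with permuting the
  entries. The induction starts because the input is never renumbered.\<close>

lemma hidden_relabel:
  assumes "\<pi> \<in> hidden_perms d L" "x \<in> carrier_vec (d 0)"
  shows "hidden d \<sigma> (relabel \<pi> \<theta>) x l = Matrix.vec (d l) (\<lambda>i. hidden d \<sigma> \<theta> x l $ \<pi> l i)"
proof (induction l)
  case 0
  have "\<pi> 0 = id" using assms(1) by (simp add: hidden_perms_def)
  then show ?case using assms(2) by (intro eq_vecI) auto
next
  case (Suc l)
  have "\<pi> (Suc l) i < d (Suc l) \<longleftrightarrow> i < d (Suc l)" for i
    using permutes_in_image[OF hidden_perms_permutes[OF assms(1)], of "Suc l" i] by simp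
  then show ?case
    using affine_relabel[where y = "hidden d \<sigma> \<theta> x l", OF assms(1)] hidden_carrier[where d = d, OF assms(2)]
    by (intro eq_vecI) (simp_all add: Suc)
qed

text \<open>The output layer keeps its numbering, and its affine map absorbs the permutation of the
  last hidden layer.\<close>

lemma network_relabel:
  assumes "\<pi> \<in> hidden_perms d L" "d (L + 1) = 1"
  shows "network d L \<sigma> (relabel \<pi> \<theta>) = network d L \<sigma> \<theta>"
proof -
  have "\<pi> (Suc L) = id" using assms(1) by (simp add: hidden_perms_def)
  moreover have "affine d (relabel \<pi> \<theta>) (Suc L) (hidden d \<sigma> (relabel \<pi> \<theta>) x L) =
      Matrix.vec (d (Suc L)) (\<lambda>i. affine d \<theta> (Suc L) (hidden d \<sigma> \<theta> x L) $ \<pi> (Suc L) i)"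
    if "x \<in> carrier_vec (d 0)" for x
    unfolding hidden_relabel[OF assms(1) that]
    using assms(1) that by (intro affine_relabel hidden_carrier)
  ultimately show ?thesis
    unfolding network_def using assms(2) by (intro restrict_ext) simp
qed

lemma is_erm_relabel:
  assumes "\<pi> \<in> hidden_perms d L" "d (L + 1) = 1" "is_erm d L \<sigma> B R \<theta>"
  shows "is_erm d L \<sigma> B R (relabel \<pi> \<theta>)"
proof -
  have "relabel \<pi> \<theta> \<in> param_space d L B"
    using assms(3) bij_betwE[OF bij_betw_renumber[OF assms(1)]]
    by (simp add: is_erm_def param_space_def relabel_eq)
  then show ?thesis
    using assms by (simp add: is_erm_def network_relabel)
qed

subsection \<open>The neighbourhoods of the renumbered parameters\<close>

lemma neighbourhoods_disjoint:
  assumes "L \<ge> 1" "\<forall>l\<le>L. d l \<ge> 1" "\<pi> \<in> hidden_perms d L" "\<rho> \<in> hidden_perms d L"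
    and l: "l \<in> {1..L}" and prev: "\<pi> (l - 1) = \<rho> (l - 1)"
    and rows: "mat (d l) (d (l - 1) + 1) (\<lambda>(i, j). layer_mat d \<theta> l $$ (\<pi> l i, j)) \<noteq>
      mat (d l) (d (l - 1) + 1) (\<lambda>(i, j). layer_mat d \<theta> l $$ (\<rho> l i, j))"
    and near: "ereal (Delta_max d L (\<eta> - relabel \<pi> \<theta>)) \<le> Delta_min d L \<theta> / 2"
      "ereal (Delta_max d L (\<eta> - relabel \<rho> \<theta>)) \<le> Delta_min d L \<theta> / 2"
  shows False
proof -
  let ?w = "\<lambda>i c. \<theta> (addr d l i c)"
  have perms: "\<pi> l permutes {..<d l}" "\<rho> l permutes {..<d l}"
    "\<rho> (l - 1) permutes {..<d (l - 1)}"
    using assms(3,4) by (auto intro: hidden_perms_permutes)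
  have lt: "\<pi> l i < d l" "\<rho> l i < d l" if "i < d l" for i
    using that permutes_in_image[OF perms(1), of i] permutes_in_image[OF perms(2), of i] by auto
  obtain i c where ic: "i < d l" "c \<le> d (l - 1)"
    "layer_mat d \<theta> l $$ (\<pi> l i, c) \<noteq> layer_mat d \<theta> l $$ (\<rho> l i, c)"
    using rows by (auto simp: Matrix.mat_eq_iff less_Suc_eq_le)
  then have "row (layer_mat d \<theta> l) (\<pi> l i) $ c \<noteq> row (layer_mat d \<theta> l) (\<rho> l i) $ c"
    using lt by simp
  then have "row (layer_mat d \<theta> l) (\<pi> l i) \<noteq> row (layer_mat d \<theta> l) (\<rho> l i)" by metis
  then obtain c where c: "c \<le> d (l - 1)"
    "Delta_min d L \<theta> \<le> ereal \<bar>?w (\<pi> l i) c - ?w (\<rho> l i) c\<bar>" "?w (\<pi> l i) c \<noteq> ?w (\<rho> l i) c"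
    using Delta_min_le[where d = d and \<theta> = \<theta>, OF l lt(1)[OF ic(1)] lt(2)[OF ic(1)]] by metis
  have "\<rho> (l - 1) permutes {..d (l - 1)}" using perms(3) by (rule permutes_subset) auto
  \<comment> \<open>Position \<open>b\<close> is where column \<open>c\<close> of \<theta> ends up
    in layer \<open>l\<close>. By \<open>prev\<close> it is the same for both renumberings, so both
    are compared with the same entries of \<eta>.\<close>
  then obtain b where b: "b \<le> d (l - 1)" "\<rho> (l - 1) b = c"
    using c(1) permutes_image by (metis atMost_iff imageE)
  define u where "u k = ?w (\<pi> l k) c - ?w (\<rho> l k) c" for k
  \<comment> \<open>Both terms run through the whole column \<open>c\<close>, in different
    orders.\<close>
  have "sum u {..<d l} = 0"
    using sum.permute[OF perms(1), of "\<lambda>k. ?w k c"] sum.permute[OF perms(2), of "\<lambda>k. ?w k c"]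
    by (simp add: u_def sum_subtractf o_def)
  then obtain j where j: "j < d l" "\<bar>u i\<bar> < \<bar>u i - u j\<bar>"
    using sum_zero_gap[of "{..<d l}" u i] ic(1) c(3) by (auto simp: u_def)
  let ?a = "\<lambda>k. \<eta> (addr d l k b)"
  have "ereal \<bar>(?a i - ?w (\<pi> l i) c) - (?a j - ?w (\<pi> l j) c)\<bar> \<le> Delta_min d L \<theta> / 2"
    using near(1) l ic(1) j(1) b prev
    unfolding Delta_max_le_iff[OF assms(1,2)] minus_apply relabel_eq renumber_addr[OF assms(3)]
    by fastforce
  moreover have "ereal \<bar>(?a i - ?w (\<rho> l i) c) - (?a j - ?w (\<rho> l j) c)\<bar> \<le> Delta_min d L \<theta> / 2"
    using near(2) l ic(1) j(1) b
    unfolding Delta_max_le_iff[OF assms(1,2)] minus_apply relabel_eq renumber_addr[OF assms(4)]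
    by fastforce
  \<comment> \<open>An actual row difference bounds \<open>Delta_min\<close> from above by a real,
    and the closeness of \<eta> excludes minus infinity.\<close>
  moreover obtain \<delta> where "Delta_min d L \<theta> = ereal \<delta>"
    using c(2) calculation by (cases "Delta_min d L \<theta>") auto
  moreover define y z where "y = (?a i - ?w (\<pi> l i) c) - (?a j - ?w (\<pi> l j) c)"
    and "z = (?a i - ?w (\<rho> l i) c) - (?a j - ?w (\<rho> l j) c)"
  ultimately have "\<bar>y\<bar> \<le> \<delta> / 2" "\<bar>z\<bar> \<le> \<delta> / 2" "\<delta> \<le> \<bar>u i\<bar>"
    using c(2) by (simp_all add: u_def)
  \<comment> \<open>The entries of \<eta> cancel, so |u i - u j| <= \<delta> <= |u i|, against the
    choice of \<open>j\<close>.\<close>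
  moreover have "u i - u j = z - y"
    by (simp add: u_def y_def z_def)
  ultimately show False
    using j(2) by linarith
qed

section \<open>Invariance of the law of the initialization\<close>

text \<open>By independence the joint law is the product of the marginals. Reindexing by
  \<open>g\<close> permutes the factors, and \<open>law\<close> says that this leaves each factor
  unchanged.\<close>

lemma (in prob_space) prob_permuted_indep_vars:
  assumes indep: "indep_vars (\<lambda>_. N) X I" and "I \<noteq> {}"
    and g: "bij_betw g I I"
    and law: "\<And>i. i \<in> I \<Longrightarrow> distr M N (X (g i)) = distr M N (X i)"
    and A: "A \<in> sets (Pi\<^sub>M I (\<lambda>_. N))"
  shows "prob {\<omega> \<in> space M. (\<lambda>i\<in>I. X (g i) \<omega>) \<in> A} = prob {\<omega> \<in> space M. (\<lambda>i\<in>I. X i \<omega>) \<in> A}"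
proof -
  let ?P = "Pi\<^sub>M I (\<lambda>_. N)" and ?D = "\<lambda>i. distr M N (X i)"
  have rv: "random_variable N (X i)" if "i \<in> I" for i
    using indep that by (auto simp: indep_vars_def)
  have gI: "g i \<in> I" if "i \<in> I" for i using g that by (auto simp: bij_betw_def)
  have X: "(\<lambda>\<omega>. \<lambda>i\<in>I. X i \<omega>) \<in> measurable M ?P"
    using rv by (rule measurable_restrict)
  have Xg: "(\<lambda>\<omega>. \<lambda>i\<in>I. X (g i) \<omega>) \<in> measurable M ?P"
    using rv gI by (intro measurable_restrict) blast
  have G: "(\<lambda>x. \<lambda>i\<in>I. x (g i)) \<in> measurable ?P ?P"
    using gI by (intro measurable_restrict measurable_component_singleton)
  have joint: "distr M ?P (\<lambda>\<omega>. \<lambda>i\<in>I. X i \<omega>) = Pi\<^sub>M I ?D"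
    using indep_vars_iff_distr_eq_PiM'[of I X "\<lambda>_. N"] indep assms(2) rv by simp
  have "distr M ?P (\<lambda>\<omega>. \<lambda>i\<in>I. X (g i) \<omega>) =
      distr (distr M ?P (\<lambda>\<omega>. \<lambda>i\<in>I. X i \<omega>)) ?P (\<lambda>x. \<lambda>i\<in>I. x (g i))"
    using gI by (subst distr_distr[OF G X]) (auto intro!: distr_cong simp: fun_eq_iff)
  \<comment> \<open>The target only changes to another product measure with the same measurable
    sets.\<close>
  also have "\<dots> = distr (Pi\<^sub>M I ?D) (Pi\<^sub>M I (\<lambda>i. ?D (g i))) (\<lambda>x. \<lambda>i\<in>I. x (g i))"
    unfolding joint by (intro distr_cong refl sets_PiM_cong) simp
  also have "\<dots> = Pi\<^sub>M I (\<lambda>i. ?D (g i))"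
    using g gI by (intro distr_PiM_reindex) (auto simp: bij_betw_def intro!: prob_space_distr rv)
  also have "\<dots> = distr M ?P (\<lambda>\<omega>. \<lambda>i\<in>I. X i \<omega>)"
    unfolding joint by (intro PiM_cong refl law)
  finally have "measure (distr M ?P (\<lambda>\<omega>. \<lambda>i\<in>I. X (g i) \<omega>)) A =
      measure (distr M ?P (\<lambda>\<omega>. \<lambda>i\<in>I. X i \<omega>)) A"
    by simp
  then show ?thesis
    by (simp only: measure_distr[OF X A] measure_distr[OF Xg A] vimage_def Int_def mem_Collect_eq conj_commute)
qed

text \<open>Stated over an arbitrary \<open>N\<close> because it serves both the sample space and
  the product space of parameters.\<close>

lemma neighbourhood_measurable:
  assumes "L \<ge> 1" "\<forall>l\<le>L. d l \<ge> 1"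
    and X: "\<And>p. p \<in> param_index d L \<Longrightarrow> (\<lambda>\<omega>. X \<omega> p) \<in> borel_measurable N"
  shows "{\<omega> \<in> space N. ereal (Delta_max d L (X \<omega> - \<theta>)) \<le> r} \<in> sets N"
  unfolding Delta_max_le_iff[OF assms(1,2)] minus_apply
proof (intro sets.sets_Collect_finite_All')
  fix l i j c assume "l \<in> {1..L}" "i \<in> {..<d l}" "j \<in> {..<d l}"
  then have [measurable]: "(\<lambda>\<omega>. X \<omega> (addr d l i c)) \<in> borel_measurable N"
    "(\<lambda>\<omega>. X \<omega> (addr d l j c)) \<in> borel_measurable N"
    by (auto intro!: X addr_in_param_index)
  show "{\<omega> \<in> space N. ereal \<bar>X \<omega> (addr d l i c) - \<theta> (addr d l i c)
      - (X \<omega> (addr d l j c) - \<theta> (addr d l j c))\<bar> \<le> r} \<in> sets N"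
    by measurable
qed (use assms(1,2) in \<open>auto simp: Suc_le_eq lessThan_empty_iff\<close>)

lemma prob_neighbourhood_relabel:
  assumes "L \<ge> 1" "\<forall>l\<le>L. d l \<ge> 1" "\<pi> \<in> hidden_perms d L"
    and "prob_space M" "layerwise_iid d L M X"
  shows "measure M {\<omega> \<in> space M. ereal (Delta_max d L (X \<omega> - relabel \<pi> \<theta>)) \<le> r} =
    measure M {\<omega> \<in> space M. ereal (Delta_max d L (X \<omega> - \<theta>)) \<le> r}"
proof -
  interpret prob_space M by fact
  let ?I = "param_index d L"
  let ?N = "Pi\<^sub>M ?I (\<lambda>_. borel) :: param measure"
  define A where "A = {x \<in> space ?N. ereal (Delta_max d L (x - relabel \<pi> \<theta>)) \<le> r}"
  have indep: "indep_vars (\<lambda>_. borel) (\<lambda>p \<omega>. X \<omega> p) ?I"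
    using assms(5) by (simp add: layerwise_iid_def)
  have A: "A \<in> sets ?N"
    unfolding A_def using assms(1,2) by (rule neighbourhood_measurable) simp
  have ne: "?I \<noteq> {}"
    using addr_in_param_index[of 1 L 0 d 0] assms(1,2) by (auto simp: Suc_le_eq)
  \<comment> \<open>Renumbering keeps the layer and the kind of an address, and entries of one kind
    within a layer share their distribution.\<close>
  have law: "distr M borel (\<lambda>\<omega>. X \<omega> (renumber \<pi> p)) = distr M borel (\<lambda>\<omega>. X \<omega> p)" if "p \<in> ?I" for p
  proof -
    have lt: "\<pi> l i < d l" if "i < d l" for l i
      using that permutes_in_image[OF hidden_perms_permutes[OF assms(3)], of l i] by simp
    have W: "distr M borel (\<lambda>\<omega>. X \<omega> (Weight l i j)) = distr M borel (\<lambda>\<omega>. X \<omega> (Weight l i' j'))"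
      if "l \<in> {1..L + 1}" "i < d l" "i' < d l" "j < d (l - 1)" "j' < d (l - 1)" for l i i' j j'
      using that assms(5) unfolding layerwise_iid_def by blast
    have b: "distr M borel (\<lambda>\<omega>. X \<omega> (Bias l i)) = distr M borel (\<lambda>\<omega>. X \<omega> (Bias l i'))"
      if "l \<in> {1..L + 1}" "i < d l" "i' < d l" for l i i'
      using that assms(5) unfolding layerwise_iid_def by blast
    from that consider
      (weight) l i j where "p = Weight l i j" "l \<in> {1..L + 1}" "i < d l" "j < d (l - 1)"
      | (bias) l i where "p = Bias l i" "l \<in> {1..L + 1}" "i < d l"
      unfolding param_index_def by blast
    then show ?thesis
    proof cases
      case weight
      show ?thesis
        unfolding weight(1) renumber.simps by (intro W lt weight)
    next
      case bias
      show ?thesis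
        unfolding bias(1) renumber.simps by (intro b lt bias)
    qed
  qed
  \<comment> \<open>Points of the product space are undefined off \<open>param_index\<close>, where
    \<open>Delta_max\<close> does not look.\<close>
  have mem_A: "(\<lambda>p\<in>?I. Y p) \<in> A \<longleftrightarrow> ereal (Delta_max d L (Y - relabel \<pi> \<theta>)) \<le> r" for Y
  proof -
    have "ereal (Delta_max d L ((\<lambda>p\<in>?I. Y p) - relabel \<pi> \<theta>)) \<le> r \<longleftrightarrow>
        ereal (Delta_max d L (Y - relabel \<pi> \<theta>)) \<le> r"
      using assms(1,2) by (rule Delta_max_cong) simp
    then show ?thesis by (simp add: A_def space_PiM)
  qed
  have shift: "(\<lambda>p. X \<omega> (renumber \<pi> p)) - relabel \<pi> \<theta> = relabel \<pi> (X \<omega> - \<theta>)" for \<omega>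
    by (simp add: fun_eq_iff relabel_eq)
  have "prob {\<omega> \<in> space M. (\<lambda>p\<in>?I. X \<omega> (renumber \<pi> p)) \<in> A} =
      prob {\<omega> \<in> space M. (\<lambda>p\<in>?I. X \<omega> p) \<in> A}"
    using indep ne bij_betw_renumber[OF assms(3)] law A by (rule prob_permuted_indep_vars)
  then show ?thesis
    by (simp only: mem_A shift Delta_max_relabel_le_iff[OF assms(1,2,3)])
qed

section \<open>Counting the disjoint neighbourhoods\<close>

theorem theorem3:
  fixes d :: "nat \<Rightarrow> nat" and L :: nat and \<sigma> :: "nat \<Rightarrow> real \<Rightarrow> real" and B :: real
    and R\<^sub>n :: "(real Matrix.vec \<Rightarrow> real) \<Rightarrow> real"
    and \<theta>\<^sub>n :: param and \<delta> :: ereal and d' :: "nat \<Rightarrow> nat"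
    and \<A> :: "param \<Rightarrow> nat \<Rightarrow> param"
    and M :: "'w measure" and \<theta>\<^sub>0 :: "'w \<Rightarrow> param"
  assumes "L \<ge> 1" and "\<forall>l \<le> L. d l \<ge> 1" and "d (L + 1) = 1" and "B \<ge> 1"
    and "is_erm d L \<sigma> B R\<^sub>n \<theta>\<^sub>n"
    and "\<forall>l \<in> {1..L}. distinct_row_perms d \<theta>\<^sub>n l = d' l"
    and "Delta_min d L \<theta>\<^sub>n = \<delta>"
    and "guaranteed_near d L \<A> (\<delta> / 2) \<theta>\<^sub>n"
    and "prob_space M" and "layerwise_iid d L M \<theta>\<^sub>0"
  shows "\<exists>E \<in> sets M.
           (\<forall>\<omega> \<in> E. \<exists>\<theta>. is_erm d L \<sigma> B R\<^sub>n \<theta> \<and> converges_to d L (\<A> (\<theta>\<^sub>0 \<omega>)) \<theta>) \<and>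
           measure M E \<ge> real (\<Prod>l = 1..L. d' l) *
             measure M {\<omega> \<in> space M. ereal (Delta_max d L (\<theta>\<^sub>0 \<omega> - \<theta>\<^sub>n)) \<le> \<delta> / 2}"
proof -
  interpret prob_space M by fact
  let ?\<delta> = "Delta_min d L \<theta>\<^sub>n"
  define rearr where "rearr l \<pi> = mat (d l) (d (l - 1) + 1) (\<lambda>(i, j). layer_mat d \<theta>\<^sub>n l $$ (\<pi> i, j))"
    for l and \<pi> :: "nat \<Rightarrow> nat"
  \<comment> \<open>\<open>T l\<close> selects one permutation for each distinct arrangement of the
    rows of layer \<open>l\<close>.\<close>
  have "\<exists>T \<subseteq> {\<pi>. \<pi> permutes {..<d l}}. inj_on (rearr l) T \<and>
      rearr l ` {\<pi>. \<pi> permutes {..<d l}} = rearr l ` T" for l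
    by (metis subset_image_inj order_refl)
  then obtain T where T: "\<And>l. T l \<subseteq> {\<pi>. \<pi> permutes {..<d l}}" "\<And>l. inj_on (rearr l) (T l)"
    "\<And>l. rearr l ` {\<pi>. \<pi> permutes {..<d l}} = rearr l ` T l"
    by metis
  have finT: "finite (T l)" for l
    by (rule finite_subset[OF T(1)]) (simp add: finite_permutations)
  have cardT: "card (T l) = d' l" if "l \<in> {1..L}" for l
  proof -
    have "{rearr l \<pi> | \<pi>. \<pi> permutes {..<d l}} = rearr l ` T l"
      using T(3)[of l] by auto
    moreover have "distinct_row_perms d \<theta>\<^sub>n l = card {rearr l \<pi> | \<pi>. \<pi> permutes {..<d l}}"
      by (simp only: distinct_row_perms_def rearr_def)
    ultimately show ?thesis using T(2) assms(6) that by (simp add: card_image)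
  qed
  \<comment> \<open>Elements of \<open>PiE\<close> are undefined outside \<open>{1..L}\<close>,
    whereas \<open>hidden_perms\<close> asks for the identity there.\<close>
  define ext where "ext t l = (if l \<in> {1..L} then t l else id)" for t :: "nat \<Rightarrow> nat \<Rightarrow> nat" and l
  define G where "G t = {\<omega> \<in> space M. ereal (Delta_max d L (\<theta>\<^sub>0 \<omega> - relabel (ext t) \<theta>\<^sub>n)) \<le> ?\<delta> / 2}" for t
  let ?P = "PiE {1..L} T"
  have ext: "ext t \<in> hidden_perms d L" if "t \<in> ?P" for t
    using that T(1) by (fastforce simp: ext_def hidden_perms_def PiE_iff)
  have finP: "finite ?P" using finT by (intro finite_PiE) auto
  have "\<And>p. p \<in> param_index d L \<Longrightarrow> (\<lambda>\<omega>. \<theta>\<^sub>0 \<omega> p) \<in> borel_measurable M"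
    using assms(10) by (auto simp: layerwise_iid_def indep_vars_def)
  then have G: "G t \<in> sets M" for t
    unfolding G_def using assms(1,2) by (intro neighbourhood_measurable)
  have disj: "disjoint_family_on G ?P"
  proof (unfold disjoint_family_on_def, intro ballI impI, rule ccontr)
    fix s t assume st: "s \<in> ?P" "t \<in> ?P" "s \<noteq> t" and "G s \<inter> G t \<noteq> {}"
    then obtain \<omega> where \<omega>: "\<omega> \<in> G s" "\<omega> \<in> G t" by blast
    define differ where "differ l \<longleftrightarrow> l \<in> {1..L} \<and> s l \<noteq> t l" for l
    define l where "l = (LEAST l. differ l)"
    have "\<exists>l. differ l" using st by (metis PiE_ext differ_def)
    then have "differ l" unfolding l_def by (rule LeastI_ex)
    then have l: "l \<in> {1..L}" "s l \<noteq> t l" by (auto simp: differ_def)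
    \<comment> \<open>If \<open>l - 1\<close> is 0, it is no hidden layer, and \<open>ext\<close> is
      the identity there for both families; otherwise minimality of \<open>l\<close> makes them
      agree.\<close>
    have "\<not> differ (l - 1)"
      using l(1) by (intro not_less_Least) (simp add: l_def[symmetric])
    then have "ext s (l - 1) = ext t (l - 1)"
      by (auto simp: differ_def ext_def)
    moreover have "rearr l (ext s l) \<noteq> rearr l (ext t l)"
      using l st T(2)[of l] by (auto simp: ext_def inj_on_def PiE_iff)
    ultimately show False
      using neighbourhoods_disjoint[OF assms(1,2) ext[OF st(1)] ext[OF st(2)] l(1)] \<omega>
      by (auto simp: rearr_def G_def)
  qed
  have "prob (\<Union>t\<in>?P. G t) = (\<Sum>t\<in>?P. prob (G t))"
    using finP G disj by (intro finite_measure_finite_Union) auto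
  also have "\<dots> = (\<Sum>t\<in>?P. prob {\<omega> \<in> space M. ereal (Delta_max d L (\<theta>\<^sub>0 \<omega> - \<theta>\<^sub>n)) \<le> ?\<delta> / 2})"
    unfolding G_def by (intro sum.cong refl prob_neighbourhood_relabel assms ext)
  also have "\<dots> = real (\<Prod>l = 1..L. d' l) *
      prob {\<omega> \<in> space M. ereal (Delta_max d L (\<theta>\<^sub>0 \<omega> - \<theta>\<^sub>n)) \<le> ?\<delta> / 2}"
    using cardT by (simp add: card_PiE)
  finally have prob_E: "prob (\<Union>t\<in>?P. G t) = \<dots>" .
  have "\<exists>\<theta>. is_erm d L \<sigma> B R\<^sub>n \<theta> \<and> converges_to d L (\<A> (\<theta>\<^sub>0 \<omega>)) \<theta>" if "\<omega> \<in> (\<Union>t\<in>?P. G t)" for \<omega>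
  proof -
    from that obtain t where "t \<in> ?P" "ereal (Delta_max d L (\<theta>\<^sub>0 \<omega> - relabel (ext t) \<theta>\<^sub>n)) \<le> ?\<delta> / 2"
      by (auto simp: G_def)
    \<comment> \<open>The limit may have a numbering other than \<open>ext t\<close>, but every
      numbering of the minimizer is again a minimizer.\<close>
    then obtain \<rho> where "\<rho> \<in> hidden_perms d L" "converges_to d L (\<A> (\<theta>\<^sub>0 \<omega>)) (relabel \<rho> \<theta>\<^sub>n)"
      using assms(7,8) ext unfolding guaranteed_near_def by blast
    then show ?thesis
      using is_erm_relabel assms(3,5) by blast
  qed
  moreover have "(\<Union>t\<in>?P. G t) \<in> sets M"
    using finP G by (intro sets.finite_UN) auto
  \<comment> \<open>The union serves as \<open>E\<close>; for an arbitrary algorithm the set of all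
    convergent runs need not be measurable.\<close>
  ultimately show ?thesis
    using prob_E assms(7) by (intro bexI[of _ "\<Union>t\<in>?P. G t"]) auto
qed

end
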